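(* Let $(S,\mathrm{dist})$ be a finite metric space with $n=|S|\ge 2$ points in which every nonzero distance equals $1$ or $2$. Then either $S$ has at least $n$ distinct lines, or some line of $S$ equals $S$ (i.e., consists of all $n$ points).
   Context: For distinct points $u,v$ of a metric space $(S,\mathrm{dist})$, the line $\overline{uv}$ is defined as the set of all points $p\in S$ such that $\mathrm{dist}(p,u)+\mathrm{dist}(u,v)=\mathrm{dist}(p,v)$, or $\mathrm{dist}(u,p)+\mathrm{dist}(p,v)=\mathrm{dist}(u,v)$, or $\mathrm{dist}(u,v)+\mathrm{dist}(v,p)=\mathrm{dist}(u,p)$. Lines are regarded as sets of points, so two lines $\overline{uv}$ and $\overline{xy}$ are the same line when they are equal as subsets of $S$; "the number of distinct lines" counts distinct such subsets. *)

theory Defs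
  imports "HOL-Analysis.Abstract_Metric_Spaces"
begin

definition metric_line :: "'a set \<Rightarrow> ('a \<Rightarrow> 'a \<Rightarrow> real) \<Rightarrow> 'a \<Rightarrow> 'a \<Rightarrow> 'a set" where
  "metric_line S d u v =
    {p \<in> S. d p u + d u v = d p v \<or> d u p + d p v = d u v \<or> d u v + d v p = d u p}"

definition metric_lines :: "'a set \<Rightarrow> ('a \<Rightarrow> 'a \<Rightarrow> real) \<Rightarrow> 'a set set" where
  "metric_lines S d = {metric_line S d u v | u v. u \<in> S \<and> v \<in> S \<and> u \<noteq> v}"

end

theory Submission
  imports Defs
begin

text \<open>
  Join two points by an edge when their distance is 1. Call points with equal neighbourhoods twins,
  pick a representative of each twin class, and fix an arbitrary point \<open>x\<close>. Call a set of points
  saturated if, whenever it contains a neighbour of \<open>x\<close> that is not a representative, it contains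
  all its twins. Suppose that no line is universal, and let \<open>s\<close> be the number of neighbours of \<open>x\<close>
  that are not representatives. Three disjoint families of lines are counted.

  \<^item> The lines \<open>xp\<close>, where \<open>p\<close> is not one of these \<open>s\<close> points, are saturated. Two of them coincide
    only if one point \<open>y\<close> is adjacent to \<open>x\<close> and the other point \<open>z\<close> is not; then \<open>z\<close> is the only
    neighbour of \<open>y\<close> outside the closed neighbourhood of \<open>x\<close>, and every other neighbour of \<open>x\<close> is
    adjacent to exactly one of \<open>y\<close> and \<open>z\<close>. These pairs \<open>(y, z)\<close> form a matching; if \<open>m\<close> is its
    size, there are \<open>n - 1 - s - m\<close> such lines.
  \<^item> At least \<open>m + 1\<close> saturated lines avoid \<open>x\<close>. If \<open>m > 0\<close>, fix a pair \<open>(y\<^sub>0, z\<^sub>0)\<close> and a point \<open>u\<close>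
    outside the line \<open>y\<^sub>0z\<^sub>0\<close>; the lines are \<open>y\<^sub>0y\<close> for the other pairs \<open>(y, z)\<close>, \<open>uy\<^sub>0\<close> and \<open>uz\<^sub>0\<close>.
  \<^item> Each of the \<open>s\<close> points \<open>u\<close> yields a line that is not saturated: join \<open>u\<close> to the representative
    of a point outside the line through \<open>u\<close> and its own representative.
\<close>

section \<open>Lines of a graph, twin classes and saturation\<close>

locale finite_graph =
  fixes S :: "'a set" and E :: "'a \<Rightarrow> 'a \<Rightarrow> bool"
  assumes finite_S: "finite S"
    and card_S: "card S \<ge> 2"
    and E_sym: "E u v \<Longrightarrow> E v u"
    and E_irrefl [simp]: "\<not> E u u"
    and E_in_S: "E u v \<Longrightarrow> u \<in> S"
begin

text \<open>With distances 1 and 2 only, three distinct points are collinear exactly when they span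
  two edges and one non-edge; hence the case split on \<open>E u v\<close>.\<close>

definition line :: "'a \<Rightarrow> 'a \<Rightarrow> 'a set" where
  "line u v = {p \<in> S. p = u \<or> p = v \<or> (if E u v then E u p \<noteq> E v p else E u p \<and> E v p)}"

definition lines :: "'a set set" where
  "lines = {line u v | u v. u \<in> S \<and> v \<in> S \<and> u \<noteq> v}"

definition rep :: "'a \<Rightarrow> 'a" where
  "rep u = (SOME v. v \<in> S \<and> E v = E u)"

definition saturated :: "'a \<Rightarrow> 'a set \<Rightarrow> bool" where
  "saturated x L \<longleftrightarrow>
    (\<forall>c\<in>L. \<forall>c'\<in>S. E x c \<longrightarrow> rep c \<noteq> c \<longrightarrow> E c' = E c \<longrightarrow> c' \<in> L)"

lemma E_commute: "E u v \<longleftrightarrow> E v u"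
  using E_sym by blast

lemma E_in_S2: "E u v \<Longrightarrow> v \<in> S"
  using E_sym E_in_S by blast

lemma E_neq: "E u v \<Longrightarrow> u \<noteq> v"
  by auto

lemma line_in_lines: "u \<in> S \<Longrightarrow> v \<in> S \<Longrightarrow> u \<noteq> v \<Longrightarrow> line u v \<in> lines"
  unfolding lines_def by blast

lemma line_subset: "line u v \<subseteq> S"
  unfolding line_def by auto

lemma finite_lines: "finite lines"
proof (rule finite_subset)
  show "lines \<subseteq> Pow S" unfolding lines_def using line_subset by blast
qed (simp add: finite_S)

lemma
  assumes "u \<in> S"
  shows rep_in_S: "rep u \<in> S" and E_rep: "E (rep u) = E u"
proof -
  have "rep u \<in> S \<and> E (rep u) = E u"
    unfolding rep_def by (rule someI[of _ u]) (simp add: assms)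
  then show "rep u \<in> S" "E (rep u) = E u" by auto
qed

lemma rep_cong: "E u = E v \<Longrightarrow> rep u = rep v"
  unfolding rep_def by simp

lemma rep_rep: "u \<in> S \<Longrightarrow> rep (rep u) = rep u"
  using E_rep rep_cong by blast

lemma twin_adj: "E c = E c' \<Longrightarrow> E u c \<longleftrightarrow> E u c'"
  by (metis E_commute)

text \<open>Even an end brings its twins: they are adjacent to the other end but not to this
  one.\<close>

lemma saturated_line_adjacent:
  assumes "E a b"
  shows "saturated x (line a b)"
  unfolding saturated_def
proof (intro ballI impI)
  fix c c' assume *: "c \<in> line a b" "c' \<in> S" "E c' = E c"
  then show "c' \<in> line a b"
    using assms twin_adj[OF *(3)] E_commute[of a b] by (auto simp: line_def)
qed

text \<open>Over a non-edge only the ends can lack their twins, and saturation ignores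
  representatives and non-neighbours of \<open>x\<close>.\<close>

lemma saturated_line_nonadjacent:
  assumes "\<not> E a b" and "\<not> E x a \<or> rep a = a" and "\<not> E x b \<or> rep b = b"
  shows "saturated x (line a b)"
  unfolding saturated_def
proof (intro ballI impI)
  fix c c' assume *: "c \<in> line a b" "c' \<in> S" "E c' = E c" "E x c" "rep c \<noteq> c"
  then show "c' \<in> line a b"
    using assms twin_adj[OF *(3)] by (auto simp: line_def)
qed

end

section \<open>Coincidences among the lines through \<open>x\<close>\<close>

locale noncollinear_graph = finite_graph +
  fixes x :: 'a
  assumes no_universal: "S \<notin> lines" and x_in_S: "x \<in> S"
begin

definition nonreps :: "'a set" where
  "nonreps = {u \<in> S. E x u \<and> rep u \<noteq> u}"

definition matched :: "'a \<Rightarrow> 'a \<Rightarrow> bool" where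
  "matched y z \<longleftrightarrow> y \<in> S \<and> z \<in> S \<and> z \<noteq> x \<and> E x y \<and> \<not> E x z \<and> rep y = y \<and> line x y = line x z"

definition surplus :: "'a set" where
  "surplus = {z. \<exists>y. matched y z}"

lemma not_in_line:
  assumes "u \<in> S" "v \<in> S" "u \<noteq> v"
  obtains w where "w \<in> S" "w \<notin> line u v"
proof -
  have "line u v \<in> lines" using assms by (rule line_in_lines)
  then have "line u v \<noteq> S" using no_universal by metis
  then show ?thesis using that line_subset by blast
qed

lemma matched_edge:
  assumes "matched y z"
  shows "E y z"
proof -
  have "z \<in> line x y" using assms unfolding matched_def line_def by auto
  then show ?thesis using assms unfolding matched_def line_def by auto
qed

text \<open>Any other such \<open>p\<close> would lie on \<open>line x y\<close> but not on
  \<open>line x z\<close>, as the latter needs adjacency to \<open>x\<close>.\<close>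

lemma matched_only_outer_neighbour:
  assumes "matched y z" "E y p" "\<not> E x p"
  shows "p = x \<or> p = z"
proof (rule ccontr)
  assume "\<not> ?thesis"
  then have "p \<in> line x y" "p \<notin> line x z"
    using assms E_in_S2[OF assms(2)] by (auto simp: matched_def line_def)
  then show False using assms(1) by (simp add: matched_def)
qed

text \<open>For this \<open>p\<close>, lying on \<open>line x y\<close> means non-adjacency to
  \<open>y\<close>, while lying on \<open>line x z\<close> means adjacency to
  \<open>z\<close>.\<close>

lemma matched_inner_neighbour:
  assumes "matched y z" "E x p" "p \<noteq> y"
  shows "E y p \<longleftrightarrow> \<not> E z p"
proof -
  have "p \<in> line x y \<longleftrightarrow> p \<in> line x z" using assms(1) by (simp add: matched_def)
  then show ?thesis
    using assms E_in_S2[OF assms(2)] by (auto simp: matched_def line_def)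
qed

lemma matched_inj:
  assumes "matched y z" "matched y z'"
  shows "z = z'"
  using matched_only_outer_neighbour[OF assms(1) matched_edge[OF assms(2)]] assms(2)
  by (auto simp: matched_def)

text \<open>If neither point were adjacent to \<open>x\<close>, then \<open>p\<close> would miss
  \<open>line x q\<close>. If both are, membership of a further point \<open>r\<close> reveals
  whether \<open>r\<close> is adjacent to \<open>p\<close>, and likewise to \<open>q\<close>, so the
  two are twins.\<close>

lemma eq_lines_through_x:
  assumes "p \<in> S" "q \<in> S" "p \<noteq> x" "q \<noteq> x" "p \<noteq> q" "line x p = line x q"
  shows "E x p \<and> E x q \<and> E p = E q \<or> E x p \<and> \<not> E x q \<or> E x q \<and> \<not> E x p"
proof -
  have mem: "r \<in> line x p \<longleftrightarrow> r \<in> line x q" for r using assms(6) by simp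
  have "E x p \<or> E x q"
    using mem[of p] assms by (auto simp: line_def)
  moreover have "E p = E q" if xp: "E x p" and xq: "E x q"
  proof
    have npq: "\<not> E p q" using mem[of q] assms xp xq by (auto simp: line_def)
    fix r show "E p r = E q r"
    proof (cases "r \<in> S \<and> r \<noteq> p \<and> r \<noteq> q \<and> r \<noteq> x")
      case True
      then show ?thesis using mem[of r] xp xq by (auto simp: line_def)
    next
      case False
      then show ?thesis using npq xp xq E_sym E_in_S2 E_irrefl by metis
    qed
  qed
  ultimately show ?thesis by blast
qed

lemma saturated_line_x:
  assumes "p \<in> S - {x} - nonreps"
  shows "saturated x (line x p)"
  using assms saturated_line_adjacent[of x p x] saturated_line_nonadjacent[of x p x]
  by (cases "E x p") (auto simp: nonreps_def)

lemma inj_on_line_x: "inj_on (line x) (S - {x} - nonreps - surplus)"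
proof (rule inj_onI, rule ccontr)
  fix p q
  assume pq: "p \<in> S - {x} - nonreps - surplus" "q \<in> S - {x} - nonreps - surplus"
    "line x p = line x q" "p \<noteq> q"
  consider "E x p" "E x q" "E p = E q" | "E x p" "\<not> E x q" | "E x q" "\<not> E x p"
    using eq_lines_through_x[of p q] pq by auto
  then show False
  proof cases
    case 1
    then have "rep p = p" "rep q = q" using pq by (auto simp: nonreps_def)
    then show False using rep_cong[OF 1(3)] pq by simp
  next
    case 2
    then have "matched p q" using pq by (auto simp: nonreps_def matched_def)
    then show False using pq by (auto simp: surplus_def)
  next
    case 3
    then have "matched q p" using pq by (auto simp: nonreps_def matched_def)
    then show False using pq by (auto simp: surplus_def)
  qed
qed

section \<open>Saturated lines that avoid \<open>x\<close>\<close>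

definition avoiding :: "'a set set" where
  "avoiding = {L \<in> lines. saturated x L \<and> x \<notin> L}"

lemma finite_avoiding: "finite avoiding"
  using finite_lines by (simp add: avoiding_def)

text \<open>Otherwise the neighbours of \<open>x\<close> are independent, and \<open>x\<close> has
  at most one non-neighbour \<open>b\<close>, which is joined to all of them. Then
  \<open>line x b\<close> is universal, or, without \<open>b\<close>, the graph is a star and
  \<open>line x a\<close> is universal.\<close>

lemma avoiding_nonempty: "avoiding \<noteq> {}"
proof
  assume empty: "avoiding = {}"
  have none: "x \<in> line a b" if "a \<in> S" "b \<in> S" "a \<noteq> b" "saturated x (line a b)" for a b
    using that line_in_lines empty by (auto simp: avoiding_def)
  have nonuniv: "line a b \<noteq> S" if "a \<in> S" "b \<in> S" "a \<noteq> b" for a b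
    using that line_in_lines[of a b] no_universal by metis
  have indep: "\<not> E a b" if "E x a" "E x b" for a b
  proof
    assume ab: "E a b"
    then have "x \<in> line a b"
      using none[of a b] saturated_line_adjacent[OF ab] that E_in_S2 E_neq by blast
    then show False using ab that E_sym by (auto simp: line_def)
  qed
  have single: "b = b'" if "b \<in> S" "b' \<in> S" "b \<noteq> x" "b' \<noteq> x" "\<not> E x b" "\<not> E x b'" for b b'
  proof (rule ccontr)
    assume "b \<noteq> b'"
    moreover have "saturated x (line b b')"
      using saturated_line_adjacent saturated_line_nonadjacent that by metis
    ultimately have "x \<in> line b b'" using none that by blast
    then show False
      using that E_commute[of x b] E_commute[of x b'] by (auto simp: line_def split: if_splits)
  qed
  have joined: "E a b" if "E x a" "b \<in> S" "b \<noteq> x" "\<not> E x b" for a b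
  proof (rule ccontr)
    assume nab: "\<not> E a b"
    have a: "a \<in> S" using that E_in_S2 by blast
    \<comment> \<open>Passing to the representative of \<open>a\<close> keeps its adjacencies and
      makes the line to \<open>b\<close> saturated.\<close>
    have ra: "rep a \<in> S" "E (rep a) = E a" "rep (rep a) = rep a"
      using a rep_in_S E_rep rep_rep by auto
    have "E x (rep a)" using that twin_adj[OF ra(2)] by simp
    then have "rep a \<noteq> b" "rep a \<noteq> x" using that by auto
    moreover have "saturated x (line (rep a) b)"
      using saturated_line_nonadjacent[of "rep a" b x] ra nab that by simp
    ultimately have "x \<in> line (rep a) b" using none ra that by blast
    then show False
      using \<open>rep a \<noteq> x\<close> ra that nab E_commute[of x b] by (auto simp: line_def)
  qed
  show False
  proof (cases "\<exists>b\<in>S. b \<noteq> x \<and> \<not> E x b")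
    case True
    then obtain b where b: "b \<in> S" "b \<noteq> x" "\<not> E x b" by blast
    have "p \<in> line x b" if "p \<in> S" for p
      using that b single[of p b] joined[of p b] E_commute[of p b] by (auto simp: line_def)
    then have "line x b = S" using line_subset by blast
    then show False using nonuniv[of x b] b x_in_S by blast
  next
    case False
    have "S \<noteq> {x}" using card_S by auto
    then obtain a where a: "a \<in> S" "a \<noteq> x" using x_in_S by blast
    then have xa: "E x a" using False by blast
    have "line x a = S"
      using False xa indep[of a] by (auto simp: line_def)
    then show False using nonuniv[of x a] a x_in_S by blast
  qed
qed

text \<open>The only neighbour of \<open>y'\<close> outside the closed neighbourhood of
  \<open>x\<close> is \<open>z'\<close>, so \<open>y'\<close> misses \<open>z\<close> and must be
  adjacent to \<open>y\<close>.\<close>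

lemma matched_clique:
  assumes "matched y z" "matched y' z'" "z \<noteq> z'"
  shows "E y y'"
proof -
  have "y \<noteq> y'" using matched_inj assms by blast
  then have "E y y' \<longleftrightarrow> \<not> E z y'"
    using matched_inner_neighbour[OF assms(1), of y'] assms(2) by (auto simp: matched_def)
  moreover have "\<not> E y' z"
    using matched_only_outer_neighbour[OF assms(2), of z] assms by (auto simp: matched_def)
  ultimately show ?thesis using E_commute by blast
qed

lemma card_avoiding_gt: "card surplus < card avoiding"
proof (cases "surplus = {}")
  case True
  then show ?thesis using avoiding_nonempty finite_avoiding by (simp add: card_gt_0_iff)
next
  case False
  define f where "f z = (SOME y. matched y z)" for z
  have f: "matched (f z) z" if "z \<in> surplus" for z
    using that unfolding f_def surplus_def by (auto intro: someI)
  obtain z0 where z0: "z0 \<in> surplus" using False by blast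
  define y0 where "y0 = f z0"
  have m0: "matched y0 z0" using f z0 by (simp add: y0_def)
  then have m0': "y0 \<in> S" "z0 \<in> S" "z0 \<noteq> x" "E x y0" "\<not> E x z0" "rep y0 = y0"
    by (auto simp: matched_def)
  have yz0: "E y0 z0" using matched_edge m0 .
  have "y0 \<noteq> z0" using yz0 by auto
  then obtain u where u: "u \<in> S" "u \<notin> line y0 z0" using not_in_line m0' by metis
  \<comment> \<open>Since \<open>x\<close> lies on \<open>line y0 z0\<close>, \<open>u\<close> is
    not \<open>x\<close>. A neighbour of \<open>x\<close> other than \<open>y0\<close> would tell
    \<open>y0\<close> and \<open>z0\<close> apart, and \<open>y0\<close> has only \<open>z0\<close>
    as outer neighbour; so \<open>u\<close> is adjacent to none of \<open>x\<close>,
    \<open>y0\<close>, \<open>z0\<close>.\<close>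
  have same: "E y0 u \<longleftrightarrow> E z0 u" and u_ne: "u \<noteq> y0" "u \<noteq> z0" "u \<noteq> x"
    using u yz0 m0' E_commute[of y0 x] E_commute[of z0 x] by (auto simp: line_def)
  have xu: "\<not> E x u" using matched_inner_neighbour[OF m0, of u] u_ne same by auto
  have y0u: "\<not> E y0 u" using matched_only_outer_neighbour[OF m0, of u] xu u_ne by auto
  have z0u: "\<not> E z0 u" using y0u same by simp
  have A: "line y0 u \<in> avoiding" "y0 \<in> line y0 u" "z0 \<notin> line y0 u"
  proof -
    have "line y0 u \<in> lines" using line_in_lines[of y0 u] m0' u u_ne by simp
    moreover have "saturated x (line y0 u)"
      using saturated_line_nonadjacent[of y0 u x] m0' xu y0u by simp
    moreover have "x \<notin> line y0 u" using m0' u_ne xu y0u E_commute[of x u] by (auto simp: line_def)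
    ultimately show "line y0 u \<in> avoiding" by (simp add: avoiding_def)
    show "y0 \<in> line y0 u" "z0 \<notin> line y0 u"
      using m0' u_ne \<open>y0 \<noteq> z0\<close> y0u z0u E_commute[of u z0] by (auto simp: line_def)
  qed
  have B: "line z0 u \<in> avoiding" "y0 \<notin> line z0 u" "z0 \<in> line z0 u"
  proof -
    have "line z0 u \<in> lines" using line_in_lines[of z0 u] m0' u u_ne by simp
    moreover have "saturated x (line z0 u)"
      using saturated_line_nonadjacent[of z0 u x] m0' xu z0u by simp
    moreover have "x \<notin> line z0 u" using m0' u_ne xu z0u E_commute[of x u] by (auto simp: line_def)
    ultimately show "line z0 u \<in> avoiding" by (simp add: avoiding_def)
    show "y0 \<notin> line z0 u" "z0 \<in> line z0 u"
      using m0' u_ne \<open>y0 \<noteq> z0\<close> y0u z0u E_commute[of u y0] by (auto simp: line_def)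
  qed
  define g where "g z = line y0 (f z)" for z
  \<comment> \<open>The trace on \<open>surplus\<close> recovers \<open>z\<close>. Moreover
    \<open>g z\<close> contains both \<open>y0\<close> and \<open>z0\<close>, whereas each of the
    two lines through \<open>u\<close> contains just one of them.\<close>
  have C: "g z \<in> avoiding \<and> y0 \<in> g z \<and> g z \<inter> surplus = {z0, z}" if z: "z \<in> surplus - {z0}" for z
  proof -
    have mz: "matched (f z) z" using f z by blast
    then have mz': "f z \<in> S" "z \<in> S" "z \<noteq> x" "E x (f z)" "\<not> E x z"
      by (auto simp: matched_def)
    have adj: "E y0 (f z)" using matched_clique[OF m0 mz] z by auto
    have outer: "E y0 z' \<longleftrightarrow> z' = z0" "E (f z) z' \<longleftrightarrow> z' = z" "z' \<noteq> y0" "z' \<noteq> f z" "z' \<in> S"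
      if "z' \<in> surplus" for z'
    proof -
      have z': "z' \<noteq> x" "\<not> E x z'" "z' \<in> S" using f[OF that] by (auto simp: matched_def)
      show "E y0 z' \<longleftrightarrow> z' = z0" "E (f z) z' \<longleftrightarrow> z' = z" "z' \<noteq> y0" "z' \<noteq> f z" "z' \<in> S"
        using z' matched_only_outer_neighbour[OF m0, of z'] matched_only_outer_neighbour[OF mz, of z']
          yz0 matched_edge[OF mz] m0' mz' by auto
    qed
    have "g z \<inter> surplus = {z0, z}"
    proof (rule set_eqI)
      fix z' show "z' \<in> g z \<inter> surplus \<longleftrightarrow> z' \<in> {z0, z}"
        using outer[of z'] adj z z0 by (auto simp: g_def line_def)
    qed
    moreover have "y0 \<in> g z" using m0' by (simp add: g_def line_def)
    moreover have "x \<notin> g z" using adj m0' mz' E_sym[of x] by (auto simp: g_def line_def)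
    moreover have "g z \<in> lines" using E_neq[OF adj] m0' mz' line_in_lines[of y0 "f z"] by (simp add: g_def)
    moreover have "saturated x (g z)" using saturated_line_adjacent adj by (simp add: g_def)
    ultimately show ?thesis by (simp add: avoiding_def)
  qed
  have inj: "inj_on g (surplus - {z0})"
  proof (rule inj_onI)
    fix z z' assume "z \<in> surplus - {z0}" "z' \<in> surplus - {z0}" "g z = g z'"
    then have "{z0, z} = {z0, z'}" using C by metis
    then show "z = z'" by (auto simp: doubleton_eq_iff)
  qed
  have fin: "finite surplus"
    using finite_subset[of surplus S] finite_S by (auto simp: surplus_def matched_def)
  have "z0 \<in> g z" "y0 \<in> g z" if "z \<in> surplus - {z0}" for z using C[OF that] by auto
  then have notin: "line y0 u \<notin> g ` (surplus - {z0})" "line z0 u \<notin> g ` (surplus - {z0})"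
    using A B by auto
  have ne: "line y0 u \<noteq> line z0 u" using A B by auto
  have "card surplus > 0" using fin False by (simp add: card_gt_0_iff)
  \<comment> \<open>The image of \<open>g\<close> has one element fewer than \<open>surplus\<close>;
    the two lines through \<open>u\<close> make it one more.\<close>
  then have "card surplus < card (insert (line y0 u) (insert (line z0 u) (g ` (surplus - {z0}))))"
    using fin notin ne card_image[OF inj] z0 by simp
  also have "\<dots> \<le> card avoiding"
    using A B C by (intro card_mono finite_avoiding) auto
  finally show ?thesis .
qed

section \<open>Unsaturated lines\<close>

lemma card_nonreps_le: "card nonreps \<le> card {L \<in> lines. \<not> saturated x L}"
proof -
  have ex: "\<exists>w. w \<in> S \<and> w \<notin> line u (rep u)" if "u \<in> nonreps" for u
  proof -
    have "u \<in> S" "rep u \<in> S" "u \<noteq> rep u" using that rep_in_S[of u] by (auto simp: nonreps_def)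
    then show ?thesis using not_in_line by metis
  qed
  define w where "w u = (SOME w. w \<in> S \<and> w \<notin> line u (rep u))" for u
  have w: "w u \<in> S \<and> w u \<notin> line u (rep u)" if "u \<in> nonreps" for u
    unfolding w_def by (rule someI_ex) (rule ex[OF that])
  \<comment> \<open>With \<open>rep (w u)\<close> in place of \<open>w u\<close>, the second end
    never lies in \<open>nonreps\<close>, which injectivity relies on.\<close>
  define L where "L u = line u (rep (w u))" for u
  have L: "L u \<in> lines \<and> \<not> E u (rep (w u)) \<and> u \<in> L u \<and> (\<exists>c\<in>S. E c = E u \<and> c \<notin> L u)"
    if u: "u \<in> nonreps" for u
  proof -
    have u': "u \<in> S" "E x u" "rep u \<noteq> u" using u by (auto simp: nonreps_def)
    have ru: "rep u \<in> S" "E (rep u) = E u" using u' rep_in_S E_rep by auto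
    have urep: "\<not> E u (rep u)" using ru E_irrefl by metis
    have wu: "w u \<in> S" "w u \<noteq> u" "w u \<noteq> rep u" "\<not> E u (w u)"
      using w[OF u] urep ru by (auto simp: line_def)
    have rw: "rep (w u) \<in> S" "E (rep (w u)) = E (w u)" "rep (rep (w u)) = rep (w u)"
      using wu(1) rep_in_S E_rep rep_rep by auto
    have nadj: "\<not> E u (rep (w u))" using twin_adj[OF rw(2)] wu by simp
    have ne: "rep (w u) \<noteq> u" using rw(3) u' by metis
    \<comment> \<open>The missing twin is \<open>w u\<close> itself if it is a twin of
      \<open>u\<close>, because the line is then \<open>line u (rep u)\<close>; otherwise it is
      \<open>rep u\<close>, neither an end nor adjacent to \<open>u\<close>.\<close>
    have "\<exists>c\<in>S. E c = E u \<and> c \<notin> L u"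
    proof (cases "E (w u) = E u")
      case True
      then have "rep (w u) = rep u" by (rule rep_cong)
      then have "w u \<notin> L u" using w[OF u] by (simp add: L_def)
      then show ?thesis using True wu by blast
    next
      case False
      then have "rep (w u) \<noteq> rep u" using rw ru by metis
      then have "rep u \<notin> L u" using nadj urep u' by (auto simp: L_def line_def)
      then show ?thesis using ru by blast
    qed
    moreover have "L u \<in> lines" using line_in_lines[of u "rep (w u)"] u' rw ne by (auto simp: L_def)
    moreover have "u \<in> L u" using u' by (simp add: L_def line_def)
    ultimately show ?thesis using nadj by blast
  qed
  have "inj_on L nonreps"
  proof (rule inj_onI, rule ccontr)
    fix u v assume uv: "u \<in> nonreps" "v \<in> nonreps" "L u = L v" "u \<noteq> v"
    obtain c where c: "c \<in> S" "E c = E u" "c \<notin> L v" using L[OF uv(1)] uv(3) by auto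
    have nadj: "\<not> E v (rep (w v))" using L[OF uv(2)] by blast
    have "u \<in> L v" using L[OF uv(1)] uv(3) by blast
    moreover have "u \<noteq> rep (w v)"
      using uv(1) rep_rep[of "w v"] w[OF uv(2)] by (auto simp: nonreps_def)
    \<comment> \<open>Not being an end, \<open>u\<close> is adjacent to both ends of this non-edge,
      and then so is its twin \<open>c\<close>.\<close>
    ultimately have "E v u" "E (rep (w v)) u"
      using nadj uv(4) by (simp_all add: L_def line_def)
    then have "c \<in> L v"
      using c(1) nadj twin_adj[OF c(2)] by (simp add: L_def line_def)
    then show False using c by blast
  qed
  moreover have "L ` nonreps \<subseteq> {L \<in> lines. \<not> saturated x L}"
  proof (rule image_subsetI)
    fix u assume u: "u \<in> nonreps"
    obtain c where "c \<in> S" "E c = E u" "c \<notin> L u" "u \<in> L u" using L[OF u] by blast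
    then have "\<not> saturated x (L u)" using u unfolding saturated_def nonreps_def by blast
    then show "L u \<in> {L \<in> lines. \<not> saturated x L}" using L[OF u] by blast
  qed
  ultimately show ?thesis
    by (rule card_inj_on_le) (simp add: finite_lines)
qed

lemma card_lines_ge: "card S \<le> card lines"
proof -
  let ?D = "S - {x} - nonreps - surplus"
  let ?N = "{L \<in> lines. \<not> saturated x L}"
  have sub: "nonreps \<subseteq> S - {x}" "surplus \<subseteq> S - {x} - nonreps"
    by (auto simp: nonreps_def surplus_def matched_def)
  have fin: "finite nonreps" "finite surplus"
    using finite_subset[OF sub(1)] finite_subset[OF sub(2)] finite_S by auto
  have "card (S - {x} - nonreps) = card (S - {x}) - card nonreps"
    "card ?D = card (S - {x} - nonreps) - card surplus"
    using card_Diff_subset fin sub by auto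
  then have S: "card S \<le> 1 + card nonreps + card ?D + card surplus"
    using x_in_S finite_S by simp
  have thr: "line x ` ?D \<subseteq> {L \<in> lines. saturated x L \<and> x \<in> L}"
  proof (rule image_subsetI)
    fix p assume p: "p \<in> ?D"
    have "x \<in> line x p" using x_in_S by (simp add: line_def)
    moreover have "line x p \<in> lines" using p x_in_S by (intro line_in_lines) auto
    moreover have "saturated x (line x p)" using p by (intro saturated_line_x) simp
    ultimately show "line x p \<in> {L \<in> lines. saturated x L \<and> x \<in> L}" by simp
  qed
  have finD: "finite (line x ` ?D)" using finite_S by simp
  have finN: "finite ?N" using finite_lines by simp
  \<comment> \<open>The strict inequality in \<open>card_avoiding_gt\<close> pays for
    \<open>x\<close> itself.\<close>
  have "card S \<le> card ?N + card (line x ` ?D) + card avoiding"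
    using S card_nonreps_le card_avoiding_gt card_image[OF inj_on_line_x] by linarith
  also have "\<dots> = card (?N \<union> line x ` ?D \<union> avoiding)"
  proof -
    have "?N \<inter> line x ` ?D = {}" "(?N \<union> line x ` ?D) \<inter> avoiding = {}"
      using thr by (auto simp: avoiding_def)
    then show ?thesis using finN finD finite_avoiding by (simp add: card_Un_disjoint)
  qed
  also have "\<dots> \<le> card lines"
    using thr by (intro card_mono finite_lines) (auto simp: avoiding_def)
  finally show ?thesis .
qed

end

section \<open>Translation from distances to the graph\<close>

theorem theorem1:
  fixes S :: "'a set" and d :: "'a \<Rightarrow> 'a \<Rightarrow> real"
  assumes "Metric_space S d"
    and "finite S"
    and "card S \<ge> 2"
    and "\<And>x y. x \<in> S \<Longrightarrow> y \<in> S \<Longrightarrow> d x y \<noteq> 0 \<Longrightarrow> d x y = 1 \<or> d x y = 2"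
  shows "card (metric_lines S d) \<ge> card S \<or> S \<in> metric_lines S d"
proof -
  interpret Metric_space S d by fact
  \<comment> \<open>Membership in \<open>S\<close> is built in because \<open>d\<close> may take the
    value 1 outside \<open>S\<close>.\<close>
  define E where "E u v \<longleftrightarrow> u \<in> S \<and> v \<in> S \<and> d u v = 1" for u v
  interpret finite_graph S E
    using assms(2,3) by unfold_locales (auto simp: E_def commute)
  have dist: "d u v = (if u = v then 0 else if E u v then 1 else 2)" if "u \<in> S" "v \<in> S" for u v
    using assms(4)[OF that] that by (auto simp: E_def)
  have "metric_line S d u v = line u v" if "u \<in> S" "v \<in> S" "u \<noteq> v" for u v
  proof -
    have "p \<in> metric_line S d u v \<longleftrightarrow> p \<in> line u v" if "p \<in> S" for p
      using \<open>p \<in> S\<close> \<open>u \<in> S\<close> \<open>v \<in> S\<close> \<open>u \<noteq> v\<close> E_commute[of p u] E_commute[of p v] E_commute[of v u]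
      by (auto simp: metric_line_def line_def dist)
    moreover have "metric_line S d u v \<subseteq> S" unfolding metric_line_def by auto
    ultimately show ?thesis using line_subset by blast
  qed
  then have lines_eq: "metric_lines S d = lines"
    unfolding metric_lines_def lines_def by (intro Collect_cong) metis
  obtain x where "x \<in> S" using assms(3) by fastforce
  show ?thesis
  proof (cases "S \<in> lines")
    case False
    then interpret noncollinear_graph S E x
      using \<open>x \<in> S\<close> by unfold_locales
    show ?thesis using card_lines_ge lines_eq by simp
  qed (simp add: lines_eq)
qed

end
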